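(* Let $U_1,\dots,U_m\subset\mathbb{R}^n$ be closed convex sets with $S:=\bigcap_{i=1}^mU_i\neq\varnothing$. For $x\in\mathbb{R}^n$ let $$H_i(x):=\{y\in\mathbb{R}^n:\langle x-P_{U_i}x,\;y-P_{U_i}x\rangle\le0\},\qquad \Omega(x):=\bigcap_{i=1}^mH_i(x),$$ and let $T_{\mathrm{3PM}}x:=P_{\Omega(x)}x$. Then for all $s\in S$ and all $x\in\mathbb{R}^n$, $$\|T_{\mathrm{3PM}}x-s\|^2\le\|x-s\|^2-\delta(x)^2 .$$
   Context: $P_X$ denotes the metric projection onto a nonempty closed convex set $X$ and $\delta(x):=\max_{1\le i\le m}\mathrm{dist}(x,U_i)$; $\|\cdot\|$ is the Euclidean norm associated with $\langle\cdot,\cdot\rangle$. *)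

theory Defs
  imports "HOL-Analysis.Analysis"
begin

text \<open>
  The library's \<open>closest_point X x\<close> is the metric projection \<open>P\<^sub>X x\<close> whenever \<open>X\<close> is nonempty,
  closed and convex, and \<open>infdist x X\<close> is \<open>dist(x, X)\<close> for nonempty \<open>X\<close>. The family
  \<open>U\<^sub>1, \<dots>, U\<^sub>m\<close> is a function on \<open>nat\<close> of which only the values at \<open>1..m\<close> are used.
\<close>

definition halfspace_H :: "(nat \<Rightarrow> 'a::euclidean_space set) \<Rightarrow> nat \<Rightarrow> 'a \<Rightarrow> 'a set" where
  "halfspace_H U i x =
     {y. (x - closest_point (U i) x) \<bullet> (y - closest_point (U i) x) \<le> 0}"

definition Omega :: "nat \<Rightarrow> (nat \<Rightarrow> 'a::euclidean_space set) \<Rightarrow> 'a \<Rightarrow> 'a set" where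
  "Omega m U x = (\<Inter>i\<in>{1..m}. halfspace_H U i x)"

definition T_3PM :: "nat \<Rightarrow> (nat \<Rightarrow> 'a::euclidean_space set) \<Rightarrow> 'a \<Rightarrow> 'a" where
  "T_3PM m U x = closest_point (Omega m U x) x"

text \<open>The maximum is meaningful only for \<open>m \<ge> 1\<close>.\<close>

definition max_dist :: "nat \<Rightarrow> (nat \<Rightarrow> 'a::euclidean_space set) \<Rightarrow> 'a \<Rightarrow> real" where
  "max_dist m U x = Max ((\<lambda>i. infdist x (U i)) ` {1..m})"

end

theory Submission
  imports Defs
begin

text \<open>
  Write \<open>T\<close> for \<open>T_3PM m U x\<close>. Everything rests on one inequality: if the angle at \<open>p\<close>
  between \<open>x - p\<close> and \<open>y - p\<close> is not acute, then
  \<open>\<parallel>p - y\<parallel>\<^sup>2 \<le> \<parallel>x - y\<parallel>\<^sup>2 - \<parallel>x - p\<parallel>\<^sup>2\<close> (\<open>obtuse_angle_norm_le\<close>). It is used twice.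

  Each half-space contains the corresponding set, by the variational characterization of the
  projection, so \<open>Omega m U x\<close> is a closed convex set that contains every common point \<open>s\<close>.
  With \<open>p = T\<close> and \<open>y = s\<close> the inequality therefore bounds \<open>\<parallel>T - s\<parallel>\<^sup>2\<close> by
  \<open>\<parallel>x - s\<parallel>\<^sup>2 - \<parallel>x - T\<parallel>\<^sup>2\<close>.

  It remains to see that \<open>T\<close> is at distance at least \<open>max_dist m U x\<close> from \<open>x\<close>. Since \<open>T\<close> lies
  in the half-space of every \<open>i\<close>, the inequality with \<open>p\<close> the projection of \<open>x\<close> onto
  \<open>U i\<close> and \<open>y = T\<close> shows that \<open>T\<close> is no closer to \<open>x\<close> than that projection is.
  Taking for \<open>i\<close> an index that attains the maximum finishes the proof.
\<close>

lemma obtuse_angle_norm_le: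
  fixes x y p :: "'a::real_inner"
  assumes "(x - p) \<bullet> (y - p) \<le> 0"
  shows "(norm (p - y))\<^sup>2 \<le> (norm (x - y))\<^sup>2 - (norm (x - p))\<^sup>2"
proof -
  have "(norm (x - y))\<^sup>2 = (norm (x - p))\<^sup>2 + (norm (p - y))\<^sup>2 - 2 * ((x - p) \<bullet> (y - p))"
    by (simp add: power2_norm_eq_inner algebra_simps inner_commute)
  with assms show ?thesis by linarith
qed

lemma halfspace_H_eq:
  "halfspace_H U i x =
     {y. (x - closest_point (U i) x) \<bullet> y
         \<le> (x - closest_point (U i) x) \<bullet> closest_point (U i) x}"
  by (simp add: halfspace_H_def inner_diff_right)

lemma closed_Omega: "closed (Omega m U x)"
  unfolding Omega_def halfspace_H_eq by (intro closed_INT ballI closed_halfspace_le)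

lemma convex_Omega: "convex (Omega m U x)"
  unfolding Omega_def halfspace_H_eq by (intro convex_INT convex_halfspace_le)

lemma Inter_subset_Omega:
  assumes "\<And>i. i \<in> {1..m} \<Longrightarrow> closed (U i)"
    and "\<And>i. i \<in> {1..m} \<Longrightarrow> convex (U i)"
  shows "(\<Inter>i\<in>{1..m}. U i) \<subseteq> Omega m U x"
  unfolding Omega_def halfspace_H_def using assms by (auto intro!: closest_point_dot)

text \<open>
  If \<open>x\<close> is outside \<open>U i\<close>, the half-space is bounded by the hyperplane through the projection
  of \<open>x\<close> orthogonal to the displacement, so the projection is also its point nearest to \<open>x\<close>.
  Otherwise the left-hand side is \<open>0\<close>. Replacing \<open>U i\<close> by the half-space thus loses no distance.
\<close>

lemma infdist_le_dist_halfspace_H: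
  assumes "closed (U i)" "U i \<noteq> {}" "y \<in> halfspace_H U i x"
  shows "infdist x (U i) \<le> norm (x - y)"
proof -
  let ?p = "closest_point (U i) x"
  have "(norm (?p - y))\<^sup>2 \<le> (norm (x - y))\<^sup>2 - (norm (x - ?p))\<^sup>2"
    using assms(3) by (intro obtuse_angle_norm_le) (simp add: halfspace_H_def)
  then have "(norm (x - ?p))\<^sup>2 \<le> (norm (x - y))\<^sup>2"
    using zero_le_power2[of "norm (?p - y)"] by linarith
  then have "norm (x - ?p) \<le> norm (x - y)"
    by (rule power2_le_imp_le) simp
  moreover have "infdist x (U i) \<le> norm (x - ?p)"
    using infdist_le[OF closest_point_in_set[OF assms(1,2)]] by (simp add: dist_norm)
  ultimately show ?thesis by linarith
qed

theorem mainTheorem6: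
  fixes m :: nat and U :: "nat \<Rightarrow> (real ^ 'n) set"
  assumes "m \<ge> 1"
    and "\<And>i. i \<in> {1..m} \<Longrightarrow> closed (U i)"
    and "\<And>i. i \<in> {1..m} \<Longrightarrow> convex (U i)"
    and "(\<Inter>i\<in>{1..m}. U i) \<noteq> {}"
  shows "\<forall>s \<in> (\<Inter>i\<in>{1..m}. U i). \<forall>x :: real ^ 'n.
           (norm (T_3PM m U x - s))\<^sup>2 \<le> (norm (x - s))\<^sup>2 - (max_dist m U x)\<^sup>2"
proof (intro ballI allI)
  fix s x :: "real ^ 'n"
  assume s: "s \<in> (\<Inter>i\<in>{1..m}. U i)"
  let ?T = "T_3PM m U x"
  have s_Omega: "s \<in> Omega m U x"
    using Inter_subset_Omega[of m U x] assms(2,3) s by blast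
  then have T_Omega: "?T \<in> Omega m U x"
    unfolding T_3PM_def by (intro closest_point_in_set closed_Omega) auto
  have "(x - ?T) \<bullet> (s - ?T) \<le> 0"
    unfolding T_3PM_def by (rule closest_point_dot[OF convex_Omega closed_Omega s_Omega])
  then have step: "(norm (?T - s))\<^sup>2 \<le> (norm (x - s))\<^sup>2 - (norm (x - ?T))\<^sup>2"
    by (rule obtuse_angle_norm_le)
  have "max_dist m U x \<in> (\<lambda>i. infdist x (U i)) ` {1..m}"
    unfolding max_dist_def using assms(1) by (intro Max_in) auto
  then obtain i where i: "i \<in> {1..m}" and max_eq: "max_dist m U x = infdist x (U i)"
    by blast
  have "infdist x (U i) \<le> norm (x - ?T)"
  proof (rule infdist_le_dist_halfspace_H)
    show "closed (U i)" using assms(2) i by blast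
    show "U i \<noteq> {}" using s i by blast
    show "?T \<in> halfspace_H U i x" using T_Omega i unfolding Omega_def by blast
  qed
  then have "(max_dist m U x)\<^sup>2 \<le> (norm (x - ?T))\<^sup>2"
    unfolding max_eq by (intro power_mono infdist_nonneg)
  with step show "(norm (?T - s))\<^sup>2 \<le> (norm (x - s))\<^sup>2 - (max_dist m U x)\<^sup>2"
    by linarith
qed

end
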